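(* Let $M\ge N\ge1$ be integers. Under the identification of $-\gamma$ with $N$, of $q$ with $M/N$, and of $m_{2k}$ with $m'_k(-M)^k$ for $k=1,\dots,N$, the $(N,M)$-rectangular finite convolution matches the $q$-$\gamma$ convolution as a binary operation on the first $N$ nontrivial moments. That is, for all $\vec a,\vec b\in\mathbb{R}_{\ge0}^N$ with $(N,M)$-rectangular finite convolution $\vec\lambda$, and all $k=1,\dots,N$, $$(-M)^k\,m'_k(\vec\lambda)=F_k\bigl(\tfrac MN,-N;\ \{(-M)^jm'_j(\vec a)\}_{j=1}^k,\ \{(-M)^jm'_j(\vec b)\}_{j=1}^k\bigr),$$ where $F_k(q,\gamma;\{m^a_{2j}\}_{j=1}^k,\{m^b_{2j}\}_{j=1}^k)$ is the expression for the $2k$-th moment $m^c_{2k}$ of the $q$-$\gamma$ convolution in terms of the moments of the two inputs.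
   Context: Rectangular finite convolution. For $\vec a=(a_1,\dots,a_N)$ let $m'_k(\vec a)=\frac1N\sum_{i=1}^N(a_i^2)^k$. The $(N,M)$-rectangular finite convolution of $\vec a$ and $\vec b$ is the $N$-tuple $\vec\lambda=(\lambda_1,\dots,\lambda_N)$ such that $\lambda_1^2,\dots,\lambda_N^2$ are the roots (with multiplicity; known to be real and nonnegative) of $$P_{N,M}(z)=\sum_{l=0}^N(-1)^l\Bigl(\sum_{i,j\ge0,\,i+j=l}\frac{(N-i)!(N-j)!}{N!(N-l)!}\frac{(M-i)!(M-j)!}{M!(M-l)!}e_i(a_1^2,\dots,a_N^2)e_j(b_1^2,\dots,b_N^2)\Bigr)z^{N-l},$$ $e_i$ being elementary symmetric polynomials. $q$-$\gamma$ convolution. On $\mathbb{R}[[z]]$ let $\partial(z^n)=nz^{n-1}$; $d(z^n)=z^{n-1}$ for $n\ge1$, $d(1)=0$; $d'(z^n)=2z^{n-1}$ for odd $n$, $0$ for even $n$; $*_g$ multiplication by $g$; $[z^0]$ the constant term. For a sequence $\{\kappa_l\}$ with $\kappa_l=0$ for odd $l$ put $g(z)=\sum_{l\ge1}\kappa_lz^{l-1}$ and $m_{2k}=[z^0]\bigl(\partial+2\gamma d+((q-1)\gamma-\frac12)d'+*_g\bigr)^{2k-1}g(z)$. Here $m_{2k}$ is a polynomial in $\kappa_2,\dots,\kappa_{2k}$ with coefficients polynomial in $q,\gamma$, linear in $\kappa_{2k}$ with leading coefficient $\prod_{j=0}^{k-1}(2q\gamma+2j)\prod_{j=1}^{k-1}(2\gamma+2j)$,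 so conversely $\kappa_{2k}$ is a polynomial in $m_2,\dots,m_{2k}$ with coefficients rational in $q,\gamma$. The $q$-$\gamma$ convolution $\{m^c_{2k}\}$ of $\{m^a_{2k}\}$ and $\{m^b_{2k}\}$ is the sequence whose cumulants are $\kappa_{2l}(m^c)=\kappa_{2l}(m^a)+\kappa_{2l}(m^b)$, $l\ge1$. Thus $m^c_{2k}=F_k(q,\gamma;\{m^a_{2j}\}_{j\le k},\{m^b_{2j}\}_{j\le k})$ with $F_k$ polynomial in the moments and coefficients rational in $(q,\gamma)$; for $k\le N$ it can be evaluated at $(q,\gamma)=(M/N,-N)$ (substitute into the moment-cumulant formulas). *)

theory Defs
  imports "HOL-Computational_Algebra.Computational_Algebra"
begin

text \<open>
  An \<open>N\<close>-tuple is a function \<open>nat \<Rightarrow> real\<close> of which only the values at \<open>1, \<dots>, N\<close> are used.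
\<close>

section \<open>Rectangular finite convolution\<close>

definition elem_sym :: "nat \<Rightarrow> (nat \<Rightarrow> real) \<Rightarrow> nat \<Rightarrow> real" where
  "elem_sym N x i = (\<Sum>S | S \<subseteq> {1..N} \<and> card S = i. \<Prod>r\<in>S. x r)"

definition moment' :: "nat \<Rightarrow> (nat \<Rightarrow> real) \<Rightarrow> nat \<Rightarrow> real" where
  "moment' N a k = (1 / real N) * (\<Sum>i=1..N. ((a i)\<^sup>2) ^ k)"

definition rect_poly :: "nat \<Rightarrow> nat \<Rightarrow> (nat \<Rightarrow> real) \<Rightarrow> (nat \<Rightarrow> real) \<Rightarrow> real poly" where
  "rect_poly N M a b =
    (\<Sum>l=0..N. monom
       ((-1) ^ l *
        (\<Sum>(i, j) | i + j = l.
           (fact (N - i) * fact (N - j)) / (fact N * fact (N - l)) *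
           ((fact (M - i) * fact (M - j)) / (fact M * fact (M - l))) *
           elem_sym N (\<lambda>r. (a r)\<^sup>2) i * elem_sym N (\<lambda>r. (b r)\<^sup>2) j))
       (N - l))"

text \<open>
  This determines \<open>\<lambda>\<close> up to the order and the signs of its entries. The multiset
  \<open>proots\<close> contains the real roots only; comparing it with \<open>N\<close> squares says in particular that
  all \<open>N\<close> roots are real and nonnegative.
\<close>
definition is_rect_conv ::
    "nat \<Rightarrow> nat \<Rightarrow> (nat \<Rightarrow> real) \<Rightarrow> (nat \<Rightarrow> real) \<Rightarrow> (nat \<Rightarrow> real) \<Rightarrow> bool" where
  "is_rect_conv N M a b lam \<longleftrightarrow>
     proots (rect_poly N M a b) = image_mset (\<lambda>i. (lam i)\<^sup>2) (mset_set {1..N})"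

section \<open>The \<open>q\<close>-\<open>\<gamma>\<close> convolution\<close>

text \<open>
  The operator \<open>d\<close> is \<open>fps_shift 1\<close>, and \<open>d'\<close> is the following one: the coefficient of
  \<open>z ^ n\<close> in the image comes from \<open>z ^ (n + 1)\<close>, whose exponent is odd iff \<open>n\<close> is even.
\<close>
definition d_odd :: "real fps \<Rightarrow> real fps" where
  "d_odd f = Abs_fps (\<lambda>n. if even n then 2 * fps_nth f (n + 1) else 0)"

definition qg_op :: "real \<Rightarrow> real \<Rightarrow> real fps \<Rightarrow> real fps \<Rightarrow> real fps" where
  "qg_op q \<gamma> g f =
     fps_deriv f + fps_const (2 * \<gamma>) * fps_shift 1 f
     + fps_const ((q - 1) * \<gamma> - 1 / 2) * d_odd f + g * f"

definition cumulant_fps :: "(nat \<Rightarrow> real) \<Rightarrow> real fps" where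
  "cumulant_fps \<kappa> = Abs_fps (\<lambda>n. \<kappa> (n + 1))"

text \<open>
  A sequence of cumulants is given by \<open>\<kappa> l\<close>, \<open>l \<ge> 1\<close>, including the vanishing ones of odd
  order; moments are indexed by half of their order, so \<open>qg_moment q \<gamma> \<kappa> k\<close> is the moment
  \<open>m\<close> of order \<open>2k\<close>, \<open>k \<ge> 1\<close>.
\<close>
definition qg_moment :: "real \<Rightarrow> real \<Rightarrow> (nat \<Rightarrow> real) \<Rightarrow> nat \<Rightarrow> real" where
  "qg_moment q \<gamma> \<kappa> k =
     fps_nth ((qg_op q \<gamma> (cumulant_fps \<kappa>) ^^ (2 * k - 1)) (cumulant_fps \<kappa>)) 0"

text \<open>
  Inversion of the moment formula: the cumulant of order \<open>l = 2k\<close> is the solution of the linear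
  equation expressing that \<open>m k\<close> is the moment of order \<open>2k\<close>, the lower cumulants being known. See
  \<open>qg_moment_cumulant\<close> and \<open>qg_cumulant_unique\<close> below; the equation is solvable as long as the
  leading coefficient does not vanish, which for \<open>k \<le> N\<close> is the case at
  \<open>(q, \<gamma>) = (M / N, - N)\<close>. Nothing is assumed about the higher orders, where the value of
  \<open>THE\<close> may be meaningless.
\<close>
function qg_cumulant :: "real \<Rightarrow> real \<Rightarrow> (nat \<Rightarrow> real) \<Rightarrow> nat \<Rightarrow> real" where
  "qg_cumulant q \<gamma> m l =
     (if l = 0 \<or> odd l then 0
      else THE x. qg_moment q \<gamma>
             (\<lambda>i. if i < l then qg_cumulant q \<gamma> m i else if i = l then x else 0)
             (l div 2) = m (l div 2))"
  by auto
termination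
  by (relation "measure (\<lambda>(q, \<gamma>, m, l). l)") auto

declare qg_cumulant.simps [simp del]

text \<open>
  The expression \<open>F k (q, \<gamma>; m\<^sup>a, m\<^sup>b)\<close> for the moment of order \<open>2k\<close> of the convolution,
  evaluated at given real numbers \<open>q\<close> and \<open>\<gamma>\<close>. It involves only the moments of order at
  most \<open>2k\<close> (\<open>qg_conv_cong\<close> below).
\<close>
definition qg_conv :: "real \<Rightarrow> real \<Rightarrow> (nat \<Rightarrow> real) \<Rightarrow> (nat \<Rightarrow> real) \<Rightarrow> nat \<Rightarrow> real" where
  "qg_conv q \<gamma> ma mb k =
     qg_moment q \<gamma> (\<lambda>l. qg_cumulant q \<gamma> ma l + qg_cumulant q \<gamma> mb l) k"

section \<open>Well-definedness of the \<open>q\<close>-\<open>\<gamma>\<close> convolution\<close>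

definition qg_lead :: "real \<Rightarrow> real \<Rightarrow> nat \<Rightarrow> real" where
  "qg_lead q \<gamma> k = (\<Prod>j=0..<k. 2 * q * \<gamma> + 2 * real j) * (\<Prod>j=1..<k. 2 * \<gamma> + 2 * real j)"

definition lower_coeff :: "real \<Rightarrow> real \<Rightarrow> nat \<Rightarrow> real" where
  "lower_coeff q \<gamma> n = (if even n then 2 * \<gamma> + real n else 2 * q * \<gamma> + real n - 1)"

lemma qg_op_nth:
  "fps_nth (qg_op q \<gamma> g f) n =
     lower_coeff q \<gamma> (n + 1) * fps_nth f (n + 1) + (\<Sum>i=0..n. fps_nth g i * fps_nth f (n - i))"
  unfolding qg_op_def fps_add_nth fps_mult_left_const_nth fps_mult_nth[of g f]
  by (simp add: d_odd_def lower_coeff_def algebra_simps)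

lemma qg_iter_upd:
  assumes "r < p" "n + r < p"
    and low: "\<And>i. i < p \<Longrightarrow> 1 \<le> i \<Longrightarrow> \<kappa>' i = \<kappa> i" and top: "\<kappa>' p = \<kappa> p + x"
  shows "fps_nth ((qg_op q \<gamma> (cumulant_fps \<kappa>') ^^ r) (cumulant_fps \<kappa>')) n =
         fps_nth ((qg_op q \<gamma> (cumulant_fps \<kappa>) ^^ r) (cumulant_fps \<kappa>)) n +
         (if n + r + 1 = p then x * (\<Prod>i\<in>{n<..<p}. lower_coeff q \<gamma> i) else 0)"
  using assms(1,2)
proof (induction r arbitrary: n)
  case 0
  show ?case
  proof (cases "n + 1 = p")
    case True
    then have "{n<..<p} = {}" by auto
    with True top show ?thesis by (simp add: cumulant_fps_def)
  next
    case False
    with 0 low[of "n + 1"] show ?thesis by (simp add: cumulant_fps_def)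
  qed
next
  case (Suc r)
  let ?u' = "(qg_op q \<gamma> (cumulant_fps \<kappa>') ^^ r) (cumulant_fps \<kappa>')"
  let ?u = "(qg_op q \<gamma> (cumulant_fps \<kappa>) ^^ r) (cumulant_fps \<kappa>)"
  have sum: "(\<Sum>i=0..n. fps_nth (cumulant_fps \<kappa>') i * fps_nth ?u' (n - i)) =
        (\<Sum>i=0..n. fps_nth (cumulant_fps \<kappa>) i * fps_nth ?u (n - i))"
  proof (rule sum.cong)
    fix i assume "i \<in> {0..n}"
    with Suc have "i + 1 < p" "n - i + r < p" "n - i + r + 1 \<noteq> p" "r < p" by auto
    with Suc.IH[of "n - i"] low[of "i + 1"]
    show "fps_nth (cumulant_fps \<kappa>') i * fps_nth ?u' (n - i) =
          fps_nth (cumulant_fps \<kappa>) i * fps_nth ?u (n - i)"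
      by (simp add: cumulant_fps_def)
  qed simp
  have up: "fps_nth ?u' (Suc n) = fps_nth ?u (Suc n) +
      (if Suc (Suc (n + r)) = p then x * (\<Prod>i\<in>{Suc n<..<p}. lower_coeff q \<gamma> i) else 0)"
    using Suc by simp
  have prod: "(\<Prod>i\<in>{n<..<p}. lower_coeff q \<gamma> i) =
      lower_coeff q \<gamma> (Suc n) * (\<Prod>i\<in>{Suc n<..<p}. lower_coeff q \<gamma> i)"
  proof -
    have "{n<..<p} = insert (Suc n) {Suc n<..<p}" using Suc.prems by auto
    then show ?thesis by simp
  qed
  show ?case
    by (simp add: qg_op_nth sum up prod algebra_simps)
qed

lemma prod_lower_coeff:
  assumes "k \<ge> 1"
  shows "(\<Prod>i\<in>{0<..<2*k}. lower_coeff q \<gamma> i) = qg_lead q \<gamma> k"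
  using assms
proof (induction k rule: dec_induct)
  case base
  have "{0<..<2 * 1} = {1::nat}" by auto
  then show ?case by (simp add: qg_lead_def lower_coeff_def)
next
  case (step k)
  have "{0<..<2 * Suc k} = insert (2 * k + 1) (insert (2 * k) {0<..<2*k})"
    using step.hyps by auto
  then have "(\<Prod>i\<in>{0<..<2 * Suc k}. lower_coeff q \<gamma> i) =
      lower_coeff q \<gamma> (2 * k + 1) * (lower_coeff q \<gamma> (2 * k) * qg_lead q \<gamma> k)"
    using step.IH by simp
  also have "\<dots> = qg_lead q \<gamma> (Suc k)"
    using step.hyps by (simp add: qg_lead_def lower_coeff_def prod.atLeastLessThan_Suc algebra_simps)
  finally show ?case .
qed

lemma qg_moment_upd:
  assumes "k \<ge> 1" and "\<And>i. i < 2 * k \<Longrightarrow> 1 \<le> i \<Longrightarrow> \<kappa>' i = \<kappa> i"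
    and "\<kappa>' (2 * k) = \<kappa> (2 * k) + x"
  shows "qg_moment q \<gamma> \<kappa>' k = qg_moment q \<gamma> \<kappa> k + qg_lead q \<gamma> k * x"
  using qg_iter_upd[of "2 * k - 1" "2 * k" 0 \<kappa>' \<kappa> x q \<gamma>] assms
  by (simp add: qg_moment_def prod_lower_coeff)

lemma qg_moment_cong:
  assumes "k \<ge> 1" and "\<And>i. 1 \<le> i \<Longrightarrow> i \<le> 2 * k \<Longrightarrow> \<kappa>' i = \<kappa> i"
  shows "qg_moment q \<gamma> \<kappa>' k = qg_moment q \<gamma> \<kappa> k"
  using qg_moment_upd[of k \<kappa>' \<kappa> 0 q \<gamma>] assms by simp

lemma qg_cumulant_odd [simp]: "odd l \<Longrightarrow> qg_cumulant q \<gamma> m l = 0"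
  by (simp add: qg_cumulant.simps)

lemma qg_moment_cumulant:
  assumes "k \<ge> 1" "qg_lead q \<gamma> k \<noteq> 0"
  shows "qg_moment q \<gamma> (qg_cumulant q \<gamma> m) k = m k"
proof -
  let ?c = "qg_cumulant q \<gamma> m"
  define K where "K = (\<lambda>x i. if i < 2 * k then ?c i else if i = 2 * k then x else 0)"
  have mom: "qg_moment q \<gamma> (K x) k = qg_moment q \<gamma> (K 0) k + qg_lead q \<gamma> k * x" for x
    using assms(1) by (intro qg_moment_upd) (auto simp: K_def)
  define x0 where "x0 = (m k - qg_moment q \<gamma> (K 0) k) / qg_lead q \<gamma> k"
  have ex: "qg_moment q \<gamma> (K x) k = m k \<longleftrightarrow> x = x0" for x
    using assms(2) by (subst mom) (auto simp: x0_def field_simps)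
  have "?c (2 * k) = (THE x. qg_moment q \<gamma> (K x) k = m k)"
    using assms(1) by (subst qg_cumulant.simps) (simp add: K_def)
  also have "\<dots> = x0" by (simp add: ex)
  finally have c: "?c (2 * k) = x0" .
  have "qg_moment q \<gamma> ?c k = qg_moment q \<gamma> (K x0) k"
    using assms(1) c by (intro qg_moment_cong) (auto simp: K_def)
  with ex show ?thesis by simp
qed

lemma qg_cumulant_unique:
  assumes lead: "\<And>j. 1 \<le> j \<Longrightarrow> j \<le> k \<Longrightarrow> qg_lead q \<gamma> j \<noteq> 0"
    and odd0: "\<And>l. odd l \<Longrightarrow> \<kappa> l = 0"
    and mom: "\<And>j. 1 \<le> j \<Longrightarrow> j \<le> k \<Longrightarrow> qg_moment q \<gamma> \<kappa> j = m j"
    and l: "1 \<le> l" "l \<le> 2 * k"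
  shows "\<kappa> l = qg_cumulant q \<gamma> m l"
  using l
proof (induction l rule: less_induct)
  case (less l)
  show ?case
  proof (cases "odd l")
    case True
    then show ?thesis by (simp add: odd0)
  next
    case False
    then obtain j where j: "l = 2 * j" by (auto elim: evenE)
    with less.prems have jk: "1 \<le> j" "j \<le> k" by auto
    have "qg_moment q \<gamma> \<kappa> j =
        qg_moment q \<gamma> (qg_cumulant q \<gamma> m) j + qg_lead q \<gamma> j * (\<kappa> l - qg_cumulant q \<gamma> m l)"
      using jk j less by (intro qg_moment_upd) auto
    with mom[OF jk] qg_moment_cumulant[OF jk(1) lead[OF jk]] lead[OF jk]
    show ?thesis by simp
  qed
qed

lemma qg_cumulant_cong:
  assumes "\<And>j. 1 \<le> j \<Longrightarrow> 2 * j \<le> l \<Longrightarrow> m j = m' j"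
  shows "qg_cumulant q \<gamma> m l = qg_cumulant q \<gamma> m' l"
  using assms
proof (induction l rule: less_induct)
  case (less l)
  show ?case
  proof (cases "l = 0 \<or> odd l")
    case True
    then show ?thesis by (subst (1 2) qg_cumulant.simps) simp
  next
    case False
    then have "m (l div 2) = m' (l div 2)" by (intro less.prems) (auto elim!: evenE)
    moreover have "(\<lambda>i. if i < l then qg_cumulant q \<gamma> m i else if i = l then x else 0) =
        (\<lambda>i. if i < l then qg_cumulant q \<gamma> m' i else if i = l then x else 0)" for x
      using less by (intro ext) auto
    ultimately show ?thesis by (subst (1 2) qg_cumulant.simps) simp
  qed
qed

lemma qg_conv_cong:
  assumes "k \<ge> 1" "\<And>j. 1 \<le> j \<Longrightarrow> j \<le> k \<Longrightarrow> ma j = ma' j"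
    "\<And>j. 1 \<le> j \<Longrightarrow> j \<le> k \<Longrightarrow> mb j = mb' j"
  shows "qg_conv q \<gamma> ma mb k = qg_conv q \<gamma> ma' mb' k"
  unfolding qg_conv_def
proof (rule qg_moment_cong[OF assms(1)])
  fix i assume "1 \<le> i" "i \<le> 2 * k"
  with assms show "qg_cumulant q \<gamma> ma i + qg_cumulant q \<gamma> mb i =
      qg_cumulant q \<gamma> ma' i + qg_cumulant q \<gamma> mb' i"
    by (intro arg_cong2[of _ _ _ _ "(+)"] qg_cumulant_cong) auto
qed

lemma qg_lead_rect:
  assumes "1 \<le> N" "N \<le> M" "k \<le> N"
  shows "qg_lead (real M / real N) (- real N) k \<noteq> 0"
  using assms by (auto simp: qg_lead_def)

end

theory Submission
  imports Defs
begin

text \<open>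
  Put \<open>c\<^sub>i(a) = (N - i)! (M - i)! / (N! M!) e\<^sub>i(a\<^sup>2)\<close>. By Vieta, the rectangular convolution says
  exactly that \<open>c\<^sub>l(\<lambda>)\<close> is the sum of \<open>c\<^sub>i(a) c\<^sub>j(b)\<close> over \<open>i + j = l\<close>, i.e. that the generating
  functions \<open>E\<^sub>a(z) = \<Sum>\<^sub>i (M / 4)\<^sup>i c\<^sub>i(a) z\<^sup>2\<^sup>i\<close> are multiplied (modulo \<open>z\<close> to the power
  \<open>2N + 1\<close>), so that their logarithmic derivatives add up. It remains to see that the
  coefficients of \<open>E\<^sub>a' / E\<^sub>a\<close> are the cumulants of \<open>a\<close>. Writing \<open>D\<close> for the operator with
  \<open>g = E' / E\<close>, one has \<open>D 1 = g\<close>, and multiplication by the even series \<open>E\<close> conjugates \<open>D\<close> to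
  the operator with \<open>g = 0\<close> up to the correction \<open>- 2\<gamma> f(0) d E\<close>. Taking constant terms of
  \<open>E D\<^sup>2\<^sup>k 1\<close> gives a recursion for the moments which at \<open>(q, \<gamma>) = (M / N, - N)\<close> is Newton's identity
  between the power sums and the elementary symmetric polynomials of the \<open>a\<^sub>i\<^sup>2\<close>.
\<close>

section \<open>Vieta's formulas and Newton's identities\<close>

text \<open>Splitting off one linear factor lowers both the number of roots and the degree by one,
  so the size condition passes to the quotient; without roots it forces a constant. This turns the
  multiset equation of \<open>is_rect_conv\<close> into a product.\<close>

lemma proots_full_imp_factorization:
  fixes p :: "'a :: field poly"
  assumes "p \<noteq> 0" "size (proots p) = degree p"
  shows "p = smult (lead_coeff p) (\<Prod>x\<in>#proots p. [:-x, 1:])"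
  using assms
proof (induction "proots p" arbitrary: p)
  case empty
  then show ?case by (auto simp flip: empty(1) elim!: degree_eq_zeroE)
next
  case (add x A)
  have "x \<in># proots p" by (simp flip: add.hyps(2))
  then have "poly p x = 0" using add.prems(1) by simp
  then obtain q where q: "p = [:-x, 1:] * q" by (auto simp: poly_eq_0_iff_dvd)
  with add.prems(1) have [simp]: "q \<noteq> 0" by auto
  have pq: "proots p = add_mset x (proots q)" unfolding q by (subst proots_mult) auto
  with add.hyps(2) have A: "A = proots q" by simp
  have "degree p = Suc (degree q)" unfolding q by (subst degree_mult_eq) auto
  with add.prems(2) have "size (proots q) = degree q" by (simp add: pq)
  from add.hyps(1)[OF A \<open>q \<noteq> 0\<close> this]
  have "p = smult (lead_coeff q) ([:-x, 1:] * (\<Prod>x\<in>#proots q. [:-x, 1:]))"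
    unfolding q by (metis mult_smult_right)
  moreover have "lead_coeff p = lead_coeff q" unfolding q by (simp only: lead_coeff_mult) simp
  ultimately show ?case
    unfolding pq image_mset_add_mset prod_mset.add_mset by metis
qed

lemma vieta_poly:
  assumes "l \<le> N"
  shows "coeff (\<Prod>i\<in>{1..N}. [:- x i, 1:]) (N - l) = (-1) ^ l * elem_sym N x l"
proof -
  have "(\<Prod>i\<in>{1..N}. [:- x i, 1:]) = (\<Prod>i\<in>{1..N}. [:- x i:] + monom 1 1)"
    by (simp add: monom_altdef)
  also have "\<dots> = (\<Sum>S\<in>Pow {1..N}. (\<Prod>i\<in>S. [:- x i:]) * monom 1 (card ({1..N} - S)))"
    by (subst prod_add) (simp_all add: monom_power)
  also have "\<dots> = (\<Sum>S\<in>Pow {1..N}. monom ((-1) ^ card S * (\<Prod>i\<in>S. x i)) (N - card S))"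
  proof (rule sum.cong)
    fix S assume S: "S \<in> Pow {1..N}"
    then have "finite S" using finite_subset by auto
    then have "(\<Prod>i\<in>S. [:- x i:]) = [:(-1) ^ card S * (\<Prod>i\<in>S. x i):]"
      by (induction S rule: finite_induct) auto
    moreover have "card ({1..N} - S) = N - card S"
      using S \<open>finite S\<close> by (subst card_Diff_subset) auto
    ultimately show "(\<Prod>i\<in>S. [:- x i:]) * monom 1 (card ({1..N} - S)) =
        monom ((-1) ^ card S * (\<Prod>i\<in>S. x i)) (N - card S)"
      by (simp add: smult_monom)
  qed simp
  finally have "coeff (\<Prod>i\<in>{1..N}. [:- x i, 1:]) (N - l) =
      (\<Sum>S\<in>Pow {1..N}. if N - card S = N - l then (-1) ^ card S * (\<Prod>i\<in>S. x i) else 0)"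
    by (simp add: coeff_sum)
  also have "\<dots> = (\<Sum>S\<in>Pow {1..N}. if card S = l then (-1) ^ card S * (\<Prod>i\<in>S. x i) else 0)"
  proof (rule sum.cong)
    fix S assume "S \<in> Pow {1..N}"
    then have "card S \<le> N" using card_mono[of "{1..N}" S] by auto
    with assms have "N - card S = N - l \<longleftrightarrow> card S = l" by auto
    then show "(if N - card S = N - l then (-1) ^ card S * (\<Prod>i\<in>S. x i) else 0) =
        (if card S = l then (-1) ^ card S * (\<Prod>i\<in>S. x i) else 0)" by simp
  qed simp
  also have "\<dots> = (\<Sum>S | S \<subseteq> {1..N} \<and> card S = l. (-1) ^ card S * (\<Prod>i\<in>S. x i))"
    by (intro sum.mono_neutral_cong_right) auto
  also have "\<dots> = (-1) ^ l * elem_sym N x l"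
    by (simp add: elem_sym_def sum_distrib_left)
  finally show ?thesis .
qed

text \<open>The reversed polynomial of \<open>vieta_poly\<close>. Here the index is not subtracted
  from \<open>N\<close>, so the formula holds for every \<open>l\<close>, with both sides zero
  beyond \<open>N\<close>.\<close>

lemma vieta_fps:
  "fps_nth (\<Prod>i\<in>{1..N}. 1 - fps_const (x i) * fps_X) l = (-1) ^ l * elem_sym N x l"
proof -
  have "(\<Prod>i\<in>{1..N}. 1 - fps_const (x i) * fps_X) =
      (\<Prod>i\<in>{1..N}. fps_const (- x i) * fps_X + 1)"
    by (intro prod.cong) (simp_all flip: fps_const_neg)
  also have "\<dots> = (\<Sum>S\<in>Pow {1..N}. \<Prod>i\<in>S. fps_const (- x i) * fps_X)"
    by (subst prod_add) simp_all
  also have "\<dots> = (\<Sum>S\<in>Pow {1..N}.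
      fps_const ((-1) ^ card S * (\<Prod>i\<in>S. x i)) * fps_X ^ card S)"
  proof (rule sum.cong)
    fix S assume "S \<in> Pow {1..N}"
    then have "finite S" using finite_subset by auto
    then have "(\<Prod>i\<in>S. fps_const (- x i)) = fps_const ((-1) ^ card S * (\<Prod>i\<in>S. x i))"
      by (induction S rule: finite_induct) auto
    then show "(\<Prod>i\<in>S. fps_const (- x i) * fps_X) =
        fps_const ((-1) ^ card S * (\<Prod>i\<in>S. x i)) * fps_X ^ card S"
      by (simp add: prod.distrib)
  qed simp
  finally have "fps_nth (\<Prod>i\<in>{1..N}. 1 - fps_const (x i) * fps_X) l =
      (\<Sum>S\<in>Pow {1..N}. if card S = l then (-1) ^ card S * (\<Prod>i\<in>S. x i) else 0)"
    by (simp add: fps_sum_nth fps_X_power_nth if_distrib cong: if_cong)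
       (intro sum.cong; auto)
  also have "\<dots> = (\<Sum>S | S \<subseteq> {1..N} \<and> card S = l. (-1) ^ card S * (\<Prod>i\<in>S. x i))"
    by (intro sum.mono_neutral_cong_right) auto
  also have "\<dots> = (-1) ^ l * elem_sym N x l"
    by (simp add: elem_sym_def sum_distrib_left)
  finally show ?thesis .
qed

text \<open>The second factor on the left is the sum of the geometric series 1 / (1 - x X) = 1 + x X
  / (1 - x X). Multiplied by the product W, the ones give \<open>card A\<close> copies of W and the
  remainders give - X W'. Inserting one index at a time avoids dividing.\<close>

lemma newton_fps:
  fixes x :: "'b \<Rightarrow> 'a :: comm_ring_1"
  assumes "finite A"
  shows "(\<Prod>i\<in>A. 1 - fps_const (x i) * fps_X) * Abs_fps (\<lambda>n. \<Sum>i\<in>A. x i ^ n) =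
    of_nat (card A) * (\<Prod>i\<in>A. 1 - fps_const (x i) * fps_X) -
    fps_X * fps_deriv (\<Prod>i\<in>A. 1 - fps_const (x i) * fps_X)"
  using assms
proof (induction A rule: finite_induct)
  case empty
  have "Abs_fps (\<lambda>n. 0) = (0 :: 'a fps)" by (simp add: fps_eq_iff)
  then show ?case by simp
next
  case (insert i A)
  define W where "W = (\<Prod>i\<in>A. 1 - fps_const (x i) * fps_X)"
  define P where "P = Abs_fps (\<lambda>n. \<Sum>i\<in>A. x i ^ n)"
  define G where "G = Abs_fps (\<lambda>n. x i ^ n)"
  define c where "c = fps_const (x i)"
  have P: "Abs_fps (\<lambda>n. \<Sum>i\<in>insert i A. x i ^ n) = P + G"
    using insert.hyps by (simp add: P_def G_def fps_eq_iff add.commute)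
  have "fps_nth ((1 - c * fps_X) * G) n = fps_nth 1 n" for n
    by (cases n) (simp_all add: c_def G_def algebra_simps mult.assoc)
  then have G: "(1 - c * fps_X) * G = 1" by (simp add: fps_eq_iff)
  have dW: "fps_deriv ((1 - c * fps_X) * W) = (1 - c * fps_X) * fps_deriv W - c * W"
    by (simp add: c_def algebra_simps del: fps_const_neg flip: fps_const_neg)
  have IH: "W * P = of_nat (card A) * W - fps_X * fps_deriv W"
    using insert.IH by (simp add: W_def P_def)
  have "(1 - c * fps_X) * W * (P + G) = (1 - c * fps_X) * (W * P) + W * ((1 - c * fps_X) * G)"
    by (simp add: algebra_simps)
  also have "\<dots> = (1 - c * fps_X) * (of_nat (card A) * W - fps_X * fps_deriv W) + W"
    by (simp add: IH G)
  also have "\<dots> = of_nat (Suc (card A)) * ((1 - c * fps_X) * W) -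
      fps_X * fps_deriv ((1 - c * fps_X) * W)"
    unfolding dW by (simp add: algebra_simps)
  finally show ?case
    unfolding P W_def c_def prod.insert[OF insert.hyps] card_insert_disjoint[OF insert.hyps] .
qed

text \<open>Coefficient \<open>k\<close> of \<open>newton_fps\<close>. The sum includes
  \<open>s = 0\<close>, where the power sum is \<open>N\<close>; hence the factor N - k instead of
  the usual - k.\<close>

lemma newton_identity:
  "(\<Sum>s\<le>k. (-1) ^ (k - s) * elem_sym N x (k - s) * (\<Sum>i=1..N. x i ^ s)) =
     (real N - real k) * ((-1) ^ k * elem_sym N x k)"
proof -
  define W where "W = (\<Prod>i\<in>{1..N}. 1 - fps_const (x i) * fps_X)"
  have W: "fps_nth W l = (-1) ^ l * elem_sym N x l" for l
    unfolding W_def by (rule vieta_fps)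
  have WP: "W * Abs_fps (\<lambda>n. \<Sum>i=1..N. x i ^ n) = of_nat N * W - fps_X * fps_deriv W"
    using newton_fps[of "{1..N}" x] by (simp add: W_def)
  have "(\<Sum>s\<le>k. (-1) ^ (k - s) * elem_sym N x (k - s) * (\<Sum>i=1..N. x i ^ s)) =
      fps_nth (Abs_fps (\<lambda>n. \<Sum>i=1..N. x i ^ n) * W) k"
    unfolding fps_mult_nth W by (simp add: atMost_atLeast0 mult_ac)
  also have "\<dots> = (real N - real k) * ((-1) ^ k * elem_sym N x k)"
    unfolding mult.commute[of "Abs_fps _"] WP
    by (cases k) (simp_all add: W algebra_simps flip: fps_of_nat)
  finally show ?thesis .
qed

section \<open>Conjugating the operator by an even series, and the moment recursion\<close>

text \<open>The product rule and E g = E' absorb multiplication by \<open>g\<close> into the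
  derivative of E f. The operator \<open>d_odd\<close> commutes with the even series
  \<open>E\<close>, whereas \<open>fps_shift 1\<close> does so only up to the constant term of
  \<open>f\<close>; this produces the correction.\<close>

lemma mult_qg_op:
  assumes "\<And>n. odd n \<Longrightarrow> fps_nth E n = 0" and "E * g = fps_deriv E"
  shows "fps_nth (E * qg_op q \<gamma> g f) n =
    lower_coeff q \<gamma> (Suc n) * fps_nth (E * f) (Suc n) - 2 * \<gamma> * fps_nth f 0 * fps_nth E (Suc n)"
proof -
  have 1: "fps_nth (E * fps_shift 1 f) n = fps_nth (E * f) (Suc n) - fps_nth f 0 * fps_nth E (Suc n)"
    by (simp add: fps_mult_nth sum.atLeast0_atMost_Suc Suc_diff_le)
  have 2: "fps_nth (E * d_odd f) n = (if even n then 2 * fps_nth (E * f) (Suc n) else 0)"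
  proof -
    have "fps_nth (E * d_odd f) n =
        (\<Sum>i=0..n. if even n then 2 * (fps_nth E i * fps_nth f (Suc n - i)) else 0)"
      unfolding fps_mult_nth using assms(1)
      by (intro sum.cong) (auto simp: d_odd_def Suc_diff_le)
    also have "\<dots> = (if even n then 2 * (\<Sum>i=0..n. fps_nth E i * fps_nth f (Suc n - i)) else 0)"
      by (simp add: sum_distrib_left)
    \<comment> \<open>The term \<open>i = Suc n\<close> of the full product is missing from the sum,
      but for even \<open>n\<close> it carries an odd coefficient of \<open>E\<close>.\<close>
    also have "\<dots> = (if even n then 2 * fps_nth (E * f) (Suc n) else 0)"
      using assms(1)[of "Suc n"] by (simp add: fps_mult_nth)
    finally show ?thesis .
  qed
  have "E * qg_op q \<gamma> g f = fps_deriv (E * f) + fps_const (2 * \<gamma>) * (E * fps_shift 1 f) +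
      fps_const ((q - 1) * \<gamma> - 1 / 2) * (E * d_odd f)"
    by (simp add: qg_op_def algebra_simps flip: assms(2))
  then have "fps_nth (E * qg_op q \<gamma> g f) n = real (Suc n) * fps_nth (E * f) (Suc n) +
      2 * \<gamma> * fps_nth (E * fps_shift 1 f) n +
      ((q - 1) * \<gamma> - 1 / 2) * fps_nth (E * d_odd f) n"
    by (simp del: fps_shift_nth fps_deriv_mult)
  then show ?thesis
    unfolding 1 2 by (auto simp: lower_coeff_def algebra_simps)
qed

text \<open>The weight \<open>w\<close> collects the factors \<open>lower_coeff\<close> met on the
  way down. Each application of the operator trades one iteration for one higher exponent, so
  weighted coefficients telescope and only the corrections accumulate.\<close>

lemma qg_iter_recursion:
  fixes q \<gamma> :: real
  defines "w \<equiv> \<lambda>n. \<Prod>i\<in>{0<..<n}. lower_coeff q \<gamma> i"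
  assumes "\<And>n. odd n \<Longrightarrow> fps_nth E n = 0" and "E * g = fps_deriv E"
  shows "w (Suc n) * fps_nth (E * (qg_op q \<gamma> g ^^ r) 1) n =
    w (Suc (n + r)) * fps_nth E (n + r) -
    2 * \<gamma> * (\<Sum>s<r. fps_nth ((qg_op q \<gamma> g ^^ s) 1) 0 * w (n + r - s) * fps_nth E (n + r - s))"
proof (induction r arbitrary: n)
  case (Suc r)
  have w: "w (Suc (Suc n)) = lower_coeff q \<gamma> (Suc n) * w (Suc n)"
  proof -
    have "{0<..<Suc (Suc n)} = insert (Suc n) {0<..<Suc n}" by auto
    then show ?thesis by (simp add: w_def)
  qed
  have "w (Suc n) * fps_nth (E * (qg_op q \<gamma> g ^^ Suc r) 1) n =
      w (Suc (Suc n)) * fps_nth (E * (qg_op q \<gamma> g ^^ r) 1) (Suc n) -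
      2 * \<gamma> * (fps_nth ((qg_op q \<gamma> g ^^ r) 1) 0 * w (Suc n) * fps_nth E (Suc n))"
    by (simp add: mult_qg_op[OF assms(2,3)] w algebra_simps)
  also have "\<dots> = w (Suc (n + Suc r)) * fps_nth E (n + Suc r) -
    2 * \<gamma> * (\<Sum>s<Suc r. fps_nth ((qg_op q \<gamma> g ^^ s) 1) 0 * w (n + Suc r - s) *
      fps_nth E (n + Suc r - s))"
    unfolding Suc.IH by (simp add: algebra_simps Suc_diff_le)
  finally show ?case .
qed simp

text \<open>Since the operator sends 1 to \<open>cumulant_fps \<kappa>\<close>, the moment is the
  constant term of its power 2k applied to 1. This is the case \<open>n = 0\<close> of
  \<open>qg_iter_recursion\<close>, where evenness of \<open>E\<close> removes the odd
  iterates.\<close>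

lemma qg_moment_recursion:
  fixes q \<gamma> :: real
  assumes E0: "fps_nth E 0 = 1"
    and odd: "\<And>n. odd n \<Longrightarrow> fps_nth E n = 0"
    and log: "E * cumulant_fps \<kappa> = fps_deriv E"
    and "k \<ge> 1"
  shows "qg_moment q \<gamma> \<kappa> k = 2 * real k * (qg_lead q \<gamma> k * fps_nth E (2 * k)) -
    2 * \<gamma> * (\<Sum>s=1..<k. qg_moment q \<gamma> \<kappa> s * (qg_lead q \<gamma> (k - s) * fps_nth E (2 * (k - s))))"
proof -
  let ?D = "qg_op q \<gamma> (cumulant_fps \<kappa>)"
  let ?w = "\<lambda>n. \<Prod>i\<in>{0<..<n}. lower_coeff q \<gamma> i"
  define \<mu> where "\<mu> = (\<lambda>r. fps_nth ((?D ^^ r) 1) 0)"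
  have "d_odd 1 = 0" by (simp add: d_odd_def fps_eq_iff)
  moreover have "fps_shift 1 (1 :: real fps) = 0" by (simp add: fps_eq_iff)
  ultimately have D1: "?D 1 = cumulant_fps \<kappa>" by (simp add: qg_op_def)
  have mom: "qg_moment q \<gamma> \<kappa> j = \<mu> (2 * j)" if "j \<ge> 1" for j
  proof -
    from that have "2 * j = Suc (2 * j - 1)" by simp
    then have "(?D ^^ (2 * j)) 1 = (?D ^^ (2 * j - 1)) (?D 1)"
      by (metis funpow_Suc_right o_apply)
    then show ?thesis by (simp add: qg_moment_def \<mu>_def D1)
  qed
  have "{0<..<Suc (2 * k)} = insert (2 * k) {0<..<2 * k}" using \<open>k \<ge> 1\<close> by auto
  then have w: "?w (Suc (2 * k)) = (2 * \<gamma> + 2 * real k) * qg_lead q \<gamma> k"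
    using prod_lower_coeff[OF \<open>k \<ge> 1\<close>] by (simp add: lower_coeff_def)
  have "(\<Sum>r<2*k. \<mu> r * ?w (2 * k - r) * fps_nth E (2 * k - r)) =
      (\<Sum>s<k. \<mu> (2 * s) * (qg_lead q \<gamma> (k - s) * fps_nth E (2 * (k - s))))"
  proof -
    have "(\<Sum>r<2*k. \<mu> r * ?w (2 * k - r) * fps_nth E (2 * k - r)) =
        (\<Sum>r\<in>(*) 2 ` {..<k}. \<mu> r * ?w (2 * k - r) * fps_nth E (2 * k - r))"
    proof (rule sum.mono_neutral_right)
      show "\<forall>r\<in>{..<2*k} - (*) 2 ` {..<k}. \<mu> r * ?w (2 * k - r) * fps_nth E (2 * k - r) = 0"
      proof
        fix r assume r: "r \<in> {..<2*k} - (*) 2 ` {..<k}"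
        then have "odd r" by (auto elim!: evenE)
        with r have "odd (2 * k - r)" by auto
        then show "\<mu> r * ?w (2 * k - r) * fps_nth E (2 * k - r) = 0" by (simp add: odd)
      qed
    qed auto
    also have "\<dots> = (\<Sum>s<k. \<mu> (2 * s) * ?w (2 * k - 2 * s) * fps_nth E (2 * k - 2 * s))"
      by (subst sum.reindex) (auto simp: inj_on_def)
    also have "\<dots> = (\<Sum>s<k. \<mu> (2 * s) * (qg_lead q \<gamma> (k - s) * fps_nth E (2 * (k - s))))"
    proof (rule sum.cong)
      fix s assume "s \<in> {..<k}"
      then show "\<mu> (2 * s) * ?w (2 * k - 2 * s) * fps_nth E (2 * k - 2 * s) =
          \<mu> (2 * s) * (qg_lead q \<gamma> (k - s) * fps_nth E (2 * (k - s)))"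
        using prod_lower_coeff[of "k - s" q \<gamma>] by (simp flip: diff_mult_distrib2)
    qed simp
    finally show ?thesis .
  qed
  moreover have "{..<k} = insert 0 {1..<k}" using \<open>k \<ge> 1\<close> by auto
  moreover have "\<mu> 0 = 1" by (simp add: \<mu>_def)
  ultimately have sum: "(\<Sum>r<2*k. \<mu> r * ?w (2 * k - r) * fps_nth E (2 * k - r)) =
      qg_lead q \<gamma> k * fps_nth E (2 * k) +
      (\<Sum>s=1..<k. \<mu> (2 * s) * (qg_lead q \<gamma> (k - s) * fps_nth E (2 * (k - s))))"
    by simp
  have [simp]: "{0<..<Suc 0} = {}" by auto
  have "\<mu> (2 * k) = ?w (Suc (2 * k)) * fps_nth E (2 * k) -
      2 * \<gamma> * (\<Sum>r<2*k. \<mu> r * ?w (2 * k - r) * fps_nth E (2 * k - r))"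
    using qg_iter_recursion[OF odd log, of q \<gamma> 0 "2 * k"] E0 by (simp add: \<mu>_def)
  \<comment> \<open>The summand \<open>s = 0\<close> cancels the 2 \<gamma> in the factor 2 \<gamma>
    + 2 k of the top weight, leaving 2 k.\<close>
  then have "\<mu> (2 * k) = 2 * real k * (qg_lead q \<gamma> k * fps_nth E (2 * k)) -
    2 * \<gamma> * (\<Sum>s=1..<k. \<mu> (2 * s) * (qg_lead q \<gamma> (k - s) * fps_nth E (2 * (k - s))))"
    unfolding w sum by (simp add: algebra_simps)
  moreover have "(\<Sum>s=1..<k. \<mu> (2 * s) * (qg_lead q \<gamma> (k - s) * fps_nth E (2 * (k - s)))) =
      (\<Sum>s=1..<k. qg_moment q \<gamma> \<kappa> s * (qg_lead q \<gamma> (k - s) * fps_nth E (2 * (k - s))))"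
    by (intro sum.cong) (simp_all add: mom)
  ultimately show ?thesis by (simp only: mom[OF \<open>k \<ge> 1\<close>])
qed

section \<open>The recursion at (M / N, - N) as Newton's identity\<close>

definition rect_coeff :: "nat \<Rightarrow> nat \<Rightarrow> (nat \<Rightarrow> real) \<Rightarrow> nat \<Rightarrow> real" where
  "rect_coeff N M a i =
     fact (N - i) * fact (M - i) / (fact N * fact M) * elem_sym N (\<lambda>r. (a r)\<^sup>2) i"

lemma elem_sym_0 [simp]: "elem_sym N x 0 = 1"
proof -
  have "{S. S \<subseteq> {1..N} \<and> card S = 0} = {{}}"
    by (auto dest: finite_subset)
  then show ?thesis by (simp add: elem_sym_def)
qed

text \<open>At these parameters the factors of \<open>qg_lead\<close> are - 2 (M - i) for i from 0
  and - 2 (N - i) for i from 1, so both products are falling factorials up to powers of - 2. The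
  extra 2 N supplies the missing factor i = 0; an odd number of minus signs remains.\<close>

lemma qg_lead_rect_eq:
  assumes "1 \<le> j" "j \<le> N" "N \<le> M"
  shows "qg_lead (real M / real N) (- real N) j * (fact (N - j) * fact (M - j)) * (2 * real N) =
    - (4 ^ j) * (fact N * fact M)"
  using assms
proof (induction j rule: dec_induct)
  case base
  then show ?case by (simp add: qg_lead_def fact_reduce[of N] fact_reduce[of M])
next
  case (step j)
  have f: "fact (N - j) = (real N - real j) * fact (N - Suc j)"
    "fact (M - j) = (real M - real j) * fact (M - Suc j)"
    using step by (simp_all add: fact_reduce[of "N - j"] fact_reduce[of "M - j"] of_nat_diff)
  have L: "qg_lead (real M / real N) (- real N) (Suc j) =
      4 * (real N - real j) * (real M - real j) * qg_lead (real M / real N) (- real N) j"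
    using step by (simp add: qg_lead_def prod.atLeastLessThan_Suc algebra_simps)
  have "qg_lead (real M / real N) (- real N) (Suc j) *
      (fact (N - Suc j) * fact (M - Suc j)) * (2 * real N) =
      4 * (qg_lead (real M / real N) (- real N) j * (fact (N - j) * fact (M - j)) * (2 * real N))"
    unfolding L f by (simp only: mult_ac)
  also have "qg_lead (real M / real N) (- real N) j * (fact (N - j) * fact (M - j)) *
      (2 * real N) = - (4 ^ j) * (fact N * fact M)"
    using step by simp
  finally show ?case
    by (simp only: power_Suc mult_minus_left mult_minus_right mult.assoc)
qed

text \<open>Induction through \<open>qg_moment_recursion\<close>. The even coefficients of
  \<open>E\<close> are prescribed only up to order 2N, so that the result covers
  \<open>rect_fps\<close> as well as a product of two such series.\<close>

lemma qg_moment_rect: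
  assumes "1 \<le> N" "N \<le> M"
    and E: "\<And>j. j \<le> N \<Longrightarrow> fps_nth E (2 * j) = (real M / 4) ^ j * rect_coeff N M a j"
    and odd: "\<And>n. odd n \<Longrightarrow> fps_nth E n = 0"
    and log: "E * cumulant_fps \<kappa> = fps_deriv E"
    and k: "1 \<le> k" "k \<le> N"
  shows "qg_moment (real M / real N) (- real N) \<kappa> k = (- real M) ^ k * moment' N a k"
  using k
proof (induction k rule: less_induct)
  case (less k)
  define x where "x = (\<lambda>r. (a r)\<^sup>2)"
  define w where "w = (\<lambda>j. (-1) ^ j * elem_sym N x j)"
  define p where "p = (\<lambda>s. \<Sum>i=1..N. x i ^ s)"
  have mom: "moment' N a s = p s / real N" for s
    by (simp add: moment'_def p_def x_def)
  \<comment> \<open>The factorials cancel those in \<open>rect_coeff\<close>, and the powers of 4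
    cancel those in (M / 4)^j.\<close>
  have y: "qg_lead (real M / real N) (- real N) j * fps_nth E (2 * j) =
      - ((- real M) ^ j * w j / (2 * real N))" if "1 \<le> j" "j \<le> N" for j
  proof -
    let ?L = "qg_lead (real M / real N) (- real N) j"
    have "?L * (fact (N - j) * fact (M - j) / (fact N * fact M)) = - (4 ^ j / (2 * real N))"
      using qg_lead_rect_eq[OF that \<open>N \<le> M\<close>] \<open>1 \<le> N\<close> by (simp add: field_simps)
    then have "?L * rect_coeff N M a j = - (4 ^ j / (2 * real N)) * elem_sym N x j"
      unfolding rect_coeff_def x_def mult.assoc[symmetric] by (simp only:)
    then have "?L * fps_nth E (2 * j) =
        (real M / 4) ^ j * (- (4 ^ j / (2 * real N)) * elem_sym N x j)"
      unfolding E[OF that(2)] by (metis mult.left_commute)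
    then show ?thesis by (simp add: w_def power_divide flip: power_mult_distrib)
  qed
  have E0: "fps_nth E 0 = 1" using E[of 0] by (simp add: rect_coeff_def)
  have IH: "qg_moment (real M / real N) (- real N) \<kappa> s *
        (qg_lead (real M / real N) (- real N) (k - s) * fps_nth E (2 * (k - s))) =
      (- real M) ^ s * (p s / real N) * (- ((- real M) ^ (k - s) * w (k - s) / (2 * real N)))"
    if "s \<in> {1..<k}" for s
  proof -
    from that less.prems have "1 \<le> k - s" "k - s \<le> N" by auto
    from y[OF this] show ?thesis using that less.prems less.IH[of s] by (simp add: mom)
  qed
  have "qg_moment (real M / real N) (- real N) \<kappa> k =
      2 * real k * (- ((- real M) ^ k * w k / (2 * real N))) + 2 * real N *
      (\<Sum>s=1..<k. (- real M) ^ s * (p s / real N) *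
        (- ((- real M) ^ (k - s) * w (k - s) / (2 * real N))))"
    using qg_moment_recursion[OF E0 odd log less.prems(1), of "real M / real N" "- real N"]
      sum.cong[OF refl IH, of "{1..<k}"] y[OF less.prems]
    by (simp only:) simp
  also have "(\<Sum>s=1..<k. (- real M) ^ s * (p s / real N) *
        (- ((- real M) ^ (k - s) * w (k - s) / (2 * real N)))) =
      - ((- real M) ^ k / (2 * real N ^ 2)) * (\<Sum>s=1..<k. w (k - s) * p s)"
    unfolding sum_distrib_left
  proof (rule sum.cong)
    fix s assume "s \<in> {1..<k}"
    then have M: "(- real M) ^ k = (- real M) ^ s * (- real M) ^ (k - s)"
      by (simp flip: power_add)
    show "(- real M) ^ s * (p s / real N) * (- ((- real M) ^ (k - s) * w (k - s) / (2 * real N))) =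
        - ((- real M) ^ k / (2 * real N ^ 2)) * (w (k - s) * p s)"
      unfolding M by (simp add: power2_eq_square mult_ac)
  qed simp
  \<comment> \<open>Newton's identity with the terms \<open>s = 0\<close> and \<open>s = k\<close>
    split off. Its \<open>w k\<close> will cancel the leading term of the recursion, so that only
    the power sum survives.\<close>
  also have "(\<Sum>s=1..<k. w (k - s) * p s) = - real k * w k - p k"
  proof -
    have "{..k} = insert 0 (insert k {1..<k})" using less.prems by auto
    then have "(\<Sum>s\<le>k. w (k - s) * p s) = w k * p 0 + p k * w 0 + (\<Sum>s=1..<k. w (k - s) * p s)"
      using less.prems by simp
    moreover have "(\<Sum>s\<le>k. w (k - s) * p s) = (real N - real k) * w k"
      using newton_identity[of k N x] by (simp add: w_def p_def)
    moreover have "p 0 = real N" "w 0 = 1" by (simp_all add: p_def w_def)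
    ultimately show ?thesis by (simp add: algebra_simps)
  qed
  finally show ?case
    using \<open>1 \<le> N\<close> by (simp add: mom field_simps power2_eq_square)
qed

section \<open>Cumulants as coefficients of a logarithmic derivative\<close>

definition rect_fps :: "nat \<Rightarrow> nat \<Rightarrow> (nat \<Rightarrow> real) \<Rightarrow> real fps" where
  "rect_fps N M a =
     Abs_fps (\<lambda>n. if even n then (real M / 4) ^ (n div 2) * rect_coeff N M a (n div 2) else 0)"

definition rect_cumulant :: "nat \<Rightarrow> nat \<Rightarrow> (nat \<Rightarrow> real) \<Rightarrow> nat \<Rightarrow> real" where
  "rect_cumulant N M a l =
     (if l = 0 then 0 else fps_nth (fps_deriv (rect_fps N M a) / rect_fps N M a) (l - 1))"

lemma rect_coeff_0 [simp]: "rect_coeff N M a 0 = 1"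
  by (simp add: rect_coeff_def)

lemma rect_fps_cumulant:
  "rect_fps N M a * cumulant_fps (rect_cumulant N M a) = fps_deriv (rect_fps N M a)"
proof -
  have "fps_nth (rect_fps N M a) 0 \<noteq> 0" by (simp add: rect_fps_def)
  moreover have "cumulant_fps (rect_cumulant N M a) =
      fps_deriv (rect_fps N M a) / rect_fps N M a"
    by (simp add: cumulant_fps_def rect_cumulant_def fps_eq_iff)
  ultimately show ?thesis
    by (simp add: fps_divide_unit mult.left_commute[of "rect_fps N M a"]
        inverse_mult_eq_1' mult.commute)
qed

text \<open>The logarithmic derivative of an even series is odd. In coefficient \<open>n\<close> of
  E g = E', with \<open>n\<close> even, every product other than g_n E_0 has a factor that vanishes
  by induction or by evenness of E.\<close>

lemma rect_cumulant_odd: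
  assumes "odd l"
  shows "rect_cumulant N M a l = 0"
  using assms
proof (induction l rule: less_induct)
  case (less l)
  define E where "E = rect_fps N M a"
  define g where "g = cumulant_fps (rect_cumulant N M a)"
  have E: "fps_nth E i = 0" if "odd i" for i using that by (simp add: E_def rect_fps_def)
  have E0: "fps_nth E 0 = 1" by (simp add: E_def rect_fps_def)
  have g: "fps_nth g i = rect_cumulant N M a (Suc i)" for i by (simp add: g_def cumulant_fps_def)
  obtain n where l: "l = Suc n" "even n" using less.prems by (cases l) auto
  have "0 = fps_nth (fps_deriv E) n" using l E[of "Suc n"] by simp
  also have "\<dots> = (\<Sum>i=0..n. fps_nth g i * fps_nth E (n - i))"
    using rect_fps_cumulant[of N M a]
    by (simp add: E_def g_def mult.commute flip: fps_mult_nth)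
  also have "\<dots> = (\<Sum>i\<in>{n}. fps_nth g i * fps_nth E (n - i))"
  proof (rule sum.mono_neutral_right)
    show "\<forall>i\<in>{0..n} - {n}. fps_nth g i * fps_nth E (n - i) = 0"
    proof
      fix i assume i: "i \<in> {0..n} - {n}"
      show "fps_nth g i * fps_nth E (n - i) = 0"
      proof (cases "even i")
        case True
        then show ?thesis using i l less.IH[of "Suc i"] by (simp add: g)
      next
        case False
        then show ?thesis using i l E[of "n - i"] by auto
      qed
    qed
  qed auto
  finally show ?case by (simp add: E0 g l)
qed

text \<open>By \<open>qg_moment_rect\<close> these cumulants produce the required moments, and the
  inversion is unique as long as \<open>qg_lead\<close> is nonzero. Beyond order 2N it acquires the
  factor - 2N + 2N = 0.\<close>

lemma qg_cumulant_rect: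
  assumes "1 \<le> N" "N \<le> M" "1 \<le> l" "l \<le> 2 * N"
  shows "qg_cumulant (real M / real N) (- real N) (\<lambda>j. (- real M) ^ j * moment' N a j) l =
    rect_cumulant N M a l"
proof (rule sym, rule qg_cumulant_unique[where k = N])
  fix j assume "1 \<le> j" "j \<le> N"
  then show "qg_moment (real M / real N) (- real N) (rect_cumulant N M a) j =
      (- real M) ^ j * moment' N a j"
    using assms by (intro qg_moment_rect[OF _ _ _ _ rect_fps_cumulant]) (auto simp: rect_fps_def)
qed (use assms qg_lead_rect rect_cumulant_odd in auto)

section \<open>Multiplicativity of the generating functions\<close>

text \<open>Vieta applied to \<open>rect_poly\<close>: dividing its coefficients by the factorials
  depending only on \<open>l\<close> leaves a Cauchy product.\<close>

lemma rect_coeff_conv: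
  assumes "N \<le> M" "is_rect_conv N M a b lam" "l \<le> N"
  shows "rect_coeff N M lam l = (\<Sum>i=0..l. rect_coeff N M a i * rect_coeff N M b (l - i))"
proof -
  let ?p = "rect_poly N M a b"
  let ?c = "\<lambda>l. \<Sum>(i, j) | i + j = l.
           (fact (N - i) * fact (N - j)) / (fact N * fact (N - l)) *
           ((fact (M - i) * fact (M - j)) / (fact M * fact (M - l))) *
           elem_sym N (\<lambda>r. (a r)\<^sup>2) i * elem_sym N (\<lambda>r. (b r)\<^sup>2) j"
  have co: "coeff ?p (N - l) = (-1) ^ l * ?c l" if "l \<le> N" for l
  proof -
    have "coeff ?p (N - l) = (\<Sum>l'=0..N. if l' = l then (-1) ^ l' * ?c l' else 0)"
      unfolding rect_poly_def coeff_sum coeff_monom using that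
      by (intro sum.cong) auto
    then show ?thesis using that by simp
  qed
  have c: "?c l = (\<Sum>i=0..l. rect_coeff N M a i * rect_coeff N M b (l - i)) *
      (fact N * fact M / (fact (N - l) * fact (M - l)))" for l
    unfolding sum_distrib_right
    by (intro sum.reindex_bij_witness[where i = "\<lambda>i. (i, l - i)" and j = fst])
       (auto simp: rect_coeff_def mult_ac)
  have "degree ?p \<le> N"
    unfolding rect_poly_def
    by (intro degree_sum_le) (auto intro: order.trans[OF degree_monom_le])
  moreover have lead: "coeff ?p N = 1" using co[of 0] by (simp add: c)
  \<comment> \<open>As the degree is exactly \<open>N\<close>, the \<open>N\<close> squares listed
    in \<open>is_rect_conv\<close> exhaust the roots and the polynomial splits.\<close>
  ultimately have deg: "degree ?p = N" by (intro antisym le_degree) auto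
  have roots: "proots ?p = image_mset (\<lambda>i. (lam i)\<^sup>2) (mset_set {1..N})"
    using assms(2) by (simp add: is_rect_conv_def)
  have "?p = smult (lead_coeff ?p) (\<Prod>x\<in>#proots ?p. [:-x, 1:])"
    by (rule proots_full_imp_factorization) (use lead in \<open>auto simp: deg roots\<close>)
  also have "\<dots> = (\<Prod>i\<in>{1..N}. [:- (lam i)\<^sup>2, 1:])"
    by (simp add: deg lead roots prod_unfold_prod_mset image_mset.compositionality o_def)
  finally have "coeff ?p (N - l) = (-1) ^ l * elem_sym N (\<lambda>r. (lam r)\<^sup>2) l"
    using vieta_poly[OF \<open>l \<le> N\<close>, of "\<lambda>r. (lam r)\<^sup>2"] by simp
  then have "elem_sym N (\<lambda>r. (lam r)\<^sup>2) l = ?c l" using co[OF \<open>l \<le> N\<close>] by simp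
  then show ?thesis unfolding c by (simp add: rect_coeff_def[of N M lam])
qed

text \<open>The agreement with the series of \<open>lam\<close> stops at order 2N; a product of two
  polynomials of degree 2N in general continues beyond it.\<close>

lemma rect_fps_mult:
  assumes "N \<le> M" "is_rect_conv N M a b lam" "l \<le> N"
  shows "fps_nth (rect_fps N M a * rect_fps N M b) (2 * l) =
    (real M / 4) ^ l * rect_coeff N M lam l"
proof -
  let ?A = "fps_nth (rect_fps N M a)" and ?B = "fps_nth (rect_fps N M b)"
  have "fps_nth (rect_fps N M a * rect_fps N M b) (2 * l) =
      (\<Sum>n\<in>(*) 2 ` {0..l}. ?A n * ?B (2 * l - n))"
    unfolding fps_mult_nth
    by (rule sum.mono_neutral_right) (auto simp: rect_fps_def elim!: evenE)
  also have "\<dots> = (\<Sum>i=0..l. ?A (2 * i) * ?B (2 * (l - i)))"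
    by (subst sum.reindex) (auto simp: inj_on_def diff_mult_distrib2)
  also have "\<dots> = (\<Sum>i=0..l. (real M / 4) ^ l * (rect_coeff N M a i * rect_coeff N M b (l - i)))"
    by (intro sum.cong) (auto simp: rect_fps_def mult_ac simp flip: power_add)
  finally show ?thesis by (simp add: rect_coeff_conv[OF assms] sum_distrib_left)
qed

theorem theorem6p1:
  fixes N M k :: nat and a b lam :: "nat \<Rightarrow> real"
  assumes "1 \<le> N" and "N \<le> M"
    and "\<And>i. i \<in> {1..N} \<Longrightarrow> 0 \<le> a i"
    and "\<And>i. i \<in> {1..N} \<Longrightarrow> 0 \<le> b i"
    and "is_rect_conv N M a b lam"
    and "k \<in> {1..N}"
  shows "(- real M) ^ k * moment' N lam k =
    qg_conv (real M / real N) (- real N)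
      (\<lambda>j. (- real M) ^ j * moment' N a j) (\<lambda>j. (- real M) ^ j * moment' N b j) k"
proof -
  let ?A = "rect_fps N M a" and ?B = "rect_fps N M b"
  let ?\<kappa> = "\<lambda>l. rect_cumulant N M a l + rect_cumulant N M b l"
  have "cumulant_fps ?\<kappa> = cumulant_fps (rect_cumulant N M a) + cumulant_fps (rect_cumulant N M b)"
    by (simp add: cumulant_fps_def fps_eq_iff)
  then have "?A * ?B * cumulant_fps ?\<kappa> =
      ?A * cumulant_fps (rect_cumulant N M a) * ?B + ?A * (?B * cumulant_fps (rect_cumulant N M b))"
    by (simp add: algebra_simps)
  then have log: "?A * ?B * cumulant_fps ?\<kappa> = fps_deriv (?A * ?B)"
    by (simp add: rect_fps_cumulant)
  have odd: "fps_nth (?A * ?B) n = 0" if "odd n" for n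
    unfolding fps_mult_nth using that by (intro sum.neutral) (auto simp: rect_fps_def)
  \<comment> \<open>Here \<open>qg_moment_rect\<close> is applied to \<open>lam\<close> with E the
    product of the series of \<open>a\<close> and \<open>b\<close>, whose logarithmic derivative is
    exactly the sum of theirs.\<close>
  have "(- real M) ^ k * moment' N lam k = qg_moment (real M / real N) (- real N) ?\<kappa> k"
    using assms by (intro sym[OF qg_moment_rect[OF _ _ rect_fps_mult odd log]]) auto
  also have "\<dots> = qg_conv (real M / real N) (- real N)
      (\<lambda>j. (- real M) ^ j * moment' N a j) (\<lambda>j. (- real M) ^ j * moment' N b j) k"
    \<comment> \<open>The moment depends only on cumulants of order at most 2k, hence at most 2N,
      where \<open>qg_cumulant_rect\<close> identifies them.\<close>
    unfolding qg_conv_def using assms by (intro qg_moment_cong) (auto simp: qg_cumulant_rect)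
  finally show ?thesis .
qed

end
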